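(* Let $m\in\mathbb{N}$, $\beta\in(1,m+1]$, $x\in[0,\frac{m}{\beta-1}]$ and let $w\in\{0,\dots,m\}^{\mathbb{N}}$ be a $\beta$-expansion of $x$. Then: (1) (with $n$ ranging over $\mathbb{N}$) (i) $w$ is the greedy expansion of $x$ if and only if $\sigma^nw\prec g^*(1)$ whenever $w_n<m$; (ii) $w$ is the lazy expansion of $x$ if and only if $\sigma^nw\succ\overline{g^*(1)}$ whenever $w_n>0$; (iii) $w$ is the unique expansion of $x$ if and only if $\sigma^nw\prec g^*(1)$ whenever $w_n<m$ and $\sigma^nw\succ\overline{g^*(1)}$ whenever $w_n>0$. (2) (i) $0\le x<1$ and $w$ is the greedy expansion of $x$ if and only if $\sigma^nw\prec g^*(1)$ for all $n\ge0$; (ii) $\frac{m}{\beta-1}-1<x\le\frac{m}{\beta-1}$ and $w$ is the lazy expansion of $x$ if and only if $\sigma^nw\succ\overline{g^*(1)}$ for all $n\ge0$; (iii) $\frac{m}{\beta-1}-1<x<1$ and $w$ is the unique expansion of $x$ if and only if $\overline{g^*(1)}\prec\sigma^nw\prec g^*(1)$ for all $n\ge0$.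
   Context: $\mathbb{N}=\{1,2,3,\dots\}$. For $m\in\mathbb{N}$ and $\beta\in(1,m+1]$ put $a_k:=\frac{k}{\beta}$, $b_k:=\frac{k}{\beta}+\frac{m}{\beta(\beta-1)}$ and $T_k(x):=\beta x-k$ for $k\in\{0,\dots,m\}$; so $a_0=0$, $b_m=\frac{m}{\beta-1}$, and $a_k<a_{k+1}\le b_k<b_{k+1}$ for $0\le k\le m-1$. A sequence $w\in\{0,\dots,m\}^{\mathbb{N}}$ is a $\beta$-expansion of $x$ if $x=\sum_{i=1}^\infty\frac{w_i}{\beta^i}$; it is the unique expansion of $x$ if it is the only $\beta$-expansion of $x$ in $\{0,\dots,m\}^{\mathbb{N}}$. The shift is $\sigma(w_1w_2\cdots)=w_2w_3\cdots$ ($\sigma^0w=w$), and $\prec,\succ$ denote strict lexicographic order. For $k\in\{0,\dots,m\}$, $\overline{k}:=m-k$, and $\overline{w}:=(\overline{w_i})_{i\ge1}$. Define self-maps of $[0,\frac{m}{\beta-1}]$ by applying $T_k$ on the $k$-th piece of the following partitions ($k=0,\dots,m$): - greedy $G$: pieces $[a_k,a_{k+1})$ for $0\le k\le m-1$, and $[a_m,b_m]$ for $k=m$; - quasi-greedy $G^*$: pieces $[0,a_1]$ for $k=0$, $(a_k,a_{k+1}]$ for $1\le k\le m-1$, and $(a_m,b_m]$ for $k=m$; - lazy $L$: pieces $[0,b_0]$ for $k=0$, and $(b_{k-1},b_k]$ for $1\le k\le m$. For $x\in[0,\frac{m}{\beta-1}]$ the greedy expansion $g(x)=(g_n(x))_{n\ge1}$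 has $g_n(x)=k$ where $G^{n-1}x$ lies in the $k$-th piece for $G$; the quasi-greedy expansion $g^*(x)$ and lazy expansion $l(x)$ are defined in the same way from $G^*$ and $L$. *)

theory Defs
  imports Complex_Main "HOL-Library.Fun_Lexorder" "HOL-Library.FuncSet"
begin

text \<open>
  An infinite word $w_1 w_2 \ldots$ is a function \<open>w :: nat \<Rightarrow> nat\<close> indexed from 0, so \<open>w i\<close> is
  the digit $w_{i+1}$.  Strict lexicographic order on words is \<open>less_fun\<close>.
\<close>

definition words :: "nat \<Rightarrow> (nat \<Rightarrow> nat) set" where
  "words m = (UNIV \<rightarrow> {0..m})"

definition shift :: "(nat \<Rightarrow> nat) \<Rightarrow> nat \<Rightarrow> nat" where
  "shift w = (\<lambda>i. w (Suc i))"

definition reflect :: "nat \<Rightarrow> (nat \<Rightarrow> nat) \<Rightarrow> nat \<Rightarrow> nat" where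
  "reflect m w = (\<lambda>i. m - w i)"

definition is_expansion :: "nat \<Rightarrow> real \<Rightarrow> real \<Rightarrow> (nat \<Rightarrow> nat) \<Rightarrow> bool" where
  "is_expansion m \<beta> x w \<longleftrightarrow> w \<in> words m \<and> (\<lambda>i. real (w i) / \<beta> ^ Suc i) sums x"

definition is_unique_expansion :: "nat \<Rightarrow> real \<Rightarrow> real \<Rightarrow> (nat \<Rightarrow> nat) \<Rightarrow> bool" where
  "is_unique_expansion m \<beta> x w \<longleftrightarrow>
     is_expansion m \<beta> x w \<and> (\<forall>v. is_expansion m \<beta> x v \<longrightarrow> v = w)"

definition lower_end :: "real \<Rightarrow> nat \<Rightarrow> real" where
  "lower_end \<beta> k = real k / \<beta>"

definition upper_end :: "nat \<Rightarrow> real \<Rightarrow> nat \<Rightarrow> real" where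
  "upper_end m \<beta> k = real k / \<beta> + real m / (\<beta> * (\<beta> - 1))"

definition branch :: "real \<Rightarrow> nat \<Rightarrow> real \<Rightarrow> real" where
  "branch \<beta> k x = \<beta> * x - real k"

text \<open>Only the pieces with index \<open>k \<le> m\<close> are meaningful.\<close>

definition greedy_piece :: "nat \<Rightarrow> real \<Rightarrow> nat \<Rightarrow> real set" where
  "greedy_piece m \<beta> k =
     (if k < m then {lower_end \<beta> k ..< lower_end \<beta> (k + 1)}
      else {lower_end \<beta> m .. upper_end m \<beta> m})"

definition quasi_greedy_piece :: "nat \<Rightarrow> real \<Rightarrow> nat \<Rightarrow> real set" where
  "quasi_greedy_piece m \<beta> k =
     (if k = 0 then {0 .. lower_end \<beta> 1}
      else if k < m then {lower_end \<beta> k <.. lower_end \<beta> (k + 1)}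
      else {lower_end \<beta> m <.. upper_end m \<beta> m})"

definition lazy_piece :: "nat \<Rightarrow> real \<Rightarrow> nat \<Rightarrow> real set" where
  "lazy_piece m \<beta> k =
     (if k = 0 then {0 .. upper_end m \<beta> 0}
      else {upper_end m \<beta> (k - 1) <.. upper_end m \<beta> k})"

text \<open>
  The piecewise map and the digit sequence determined by a partition \<open>P 0, \<dots>, P m\<close> of
  $[0, m/(\beta-1)]$; off that interval \<open>piece_index\<close> is unspecified.
\<close>

definition piece_index :: "nat \<Rightarrow> (nat \<Rightarrow> real set) \<Rightarrow> real \<Rightarrow> nat" where
  "piece_index m P x = (THE k. k \<le> m \<and> x \<in> P k)"

definition piecewise_map :: "nat \<Rightarrow> real \<Rightarrow> (nat \<Rightarrow> real set) \<Rightarrow> real \<Rightarrow> real" where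
  "piecewise_map m \<beta> P x = branch \<beta> (piece_index m P x) x"

definition itinerary :: "nat \<Rightarrow> real \<Rightarrow> (nat \<Rightarrow> real set) \<Rightarrow> real \<Rightarrow> nat \<Rightarrow> nat" where
  "itinerary m \<beta> P x = (\<lambda>n. piece_index m P ((piecewise_map m \<beta> P ^^ n) x))"

definition greedy_expansion :: "nat \<Rightarrow> real \<Rightarrow> real \<Rightarrow> nat \<Rightarrow> nat" where
  "greedy_expansion m \<beta> = itinerary m \<beta> (greedy_piece m \<beta>)"

definition quasi_greedy_expansion :: "nat \<Rightarrow> real \<Rightarrow> real \<Rightarrow> nat \<Rightarrow> nat" where
  "quasi_greedy_expansion m \<beta> = itinerary m \<beta> (quasi_greedy_piece m \<beta>)"

definition lazy_expansion :: "nat \<Rightarrow> real \<Rightarrow> real \<Rightarrow> nat \<Rightarrow> nat" where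
  "lazy_expansion m \<beta> = itinerary m \<beta> (lazy_piece m \<beta>)"

end

theory Submission
  imports Defs
begin

text \<open>
  The argument compares the tails of a word with the word \<open>g\<^sup>*(1)\<close> twice: by value and
  lexicographically.

  Writing \<open>w\<close> as an itinerary of the greedy map says exactly that the remainder after every digit
  \<open>w\<^sub>n < m\<close> is less than \<open>1\<close>, since otherwise the digit could have been increased
  (\<open>eq_greedy_expansion_iff\<close>); the remainder is the value of the tail behind that digit.
  So the greedy characterization reduces to replacing ``the tail has value less than \<open>1\<close>'' by
  ``the tail is lexicographically smaller than \<open>g\<^sup>*(1)\<close>''.

  The word \<open>g\<^sup>*(1)\<close> has value \<open>1\<close> and all its tails have values in the half-open interval
  \<open>(0, 1]\<close>. The bound \<open>\<le> 1\<close> makes every word of value less than \<open>1\<close> lexicographically smaller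
  (\<open>less_fun_if_word_value_less\<close>). The bound \<open>> 0\<close> gives the converse for words all of whose
  relevant tails are smaller (\<open>word_value_less_if_less_fun\<close>): at the first difference the smaller
  word loses a whole unit, which only an excess of a later tail over \<open>1\<close> could compensate; that
  tail is of the same kind, and since its excess enters scaled down by at least \<open>\<beta>\<close>, there is no
  positive supremum of such excesses.

  Replacing each digit \<open>k\<close> by \<open>m - k\<close> turns values \<open>y\<close> into \<open>m/(\<beta>-1) - y\<close>, exchanges greedy
  with lazy and reverses the lexicographic order, so the lazy claims are the greedy claims for the
  reflected word. Finally, a word is a unique expansion exactly if it is both greedy and lazy: at
  the first digit where another expansion differs, a larger digit would leave a negative remainder,
  and a smaller one, after reflection, as well.
\<close>

section \<open>Values of words and of their tails\<close>

definition word_value :: "real \<Rightarrow> (nat \<Rightarrow> nat) \<Rightarrow> real" where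
  "word_value \<beta> w = (\<Sum>i. real (w i) / \<beta> ^ Suc i)"

lemma funpow_shift: "(shift ^^ n) w = (\<lambda>i. w (n + i))"
  by (induction n arbitrary: w) (simp_all add: shift_def)

lemma shift_in_words: "w \<in> words m \<Longrightarrow> (shift ^^ n) w \<in> words m"
  by (auto simp: words_def funpow_shift Pi_iff)

lemma reflect_in_words: "reflect m w \<in> words m"
  by (simp add: words_def reflect_def)

lemma reflect_reflect: "w \<in> words m \<Longrightarrow> reflect m (reflect m w) = w"
  by (auto simp: words_def reflect_def Pi_iff)

lemma funpow_shift_reflect: "(shift ^^ n) (reflect m w) = reflect m ((shift ^^ n) w)"
  by (simp add: funpow_shift reflect_def)

lemma less_fun_reflect_left:
  assumes "u \<in> words m" "v \<in> words m"
  shows "less_fun (reflect m u) v \<longleftrightarrow> less_fun (reflect m v) u"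
proof -
  have le: "u k \<le> m" "v k \<le> m" for k
    using assms by (auto simp: words_def Pi_iff)
  have "m - u k < v k \<longleftrightarrow> m - v k < u k" "m - u k = v k \<longleftrightarrow> m - v k = u k" for k
    using le[of k] by linarith+
  then show ?thesis
    by (simp add: less_fun_def reflect_def)
qed

locale digit_system =
  fixes m :: nat and \<beta> :: real
  assumes m_pos: "1 \<le> m" and base_gt_1: "1 < \<beta>" and base_le: "\<beta> \<le> real m + 1"
begin

abbreviation top_value :: real where
  "top_value \<equiv> real m / (\<beta> - 1)"

abbreviation val :: "(nat \<Rightarrow> nat) \<Rightarrow> real" where
  "val \<equiv> word_value \<beta>"

text \<open>The value of the constant word \<open>m\<close> is the fixed point of the last branch.\<close>

lemma top_value_fixed: "\<beta> * top_value - real m = top_value"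
  using base_gt_1 by (simp add: field_simps)

lemma one_le_top_value: "1 \<le> top_value"
  using base_gt_1 base_le by (simp add: field_simps)

lemma sums_top_value: "(\<lambda>i. real m / \<beta> ^ Suc i) sums top_value"
proof -
  have "(\<lambda>i. real m / \<beta> * (1 / \<beta>) ^ i) sums (real m / \<beta> * (1 / (1 - 1 / \<beta>)))"
    by (intro sums_mult geometric_sums) (use base_gt_1 in simp)
  moreover have "real m / \<beta> * (1 / (1 - 1 / \<beta>)) = top_value"
    using base_gt_1 by (simp add: field_simps)
  ultimately have "(\<lambda>i. real m / \<beta> * (1 / \<beta>) ^ i) sums top_value"
    by (simp only:)
  then show ?thesis
    by (simp add: power_divide)
qed

lemma summable_word:
  assumes "w \<in> words m"
  shows "summable (\<lambda>i. real (w i) / \<beta> ^ Suc i)"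
proof (rule summable_comparison_test'[OF sums_summable[OF sums_top_value]])
  fix n
  have "w n \<le> m"
    using assms by (auto simp: words_def Pi_iff)
  then show "norm (real (w n) / \<beta> ^ Suc n) \<le> real m / \<beta> ^ Suc n"
    using base_gt_1 by (simp add: divide_right_mono)
qed

lemma is_expansion_iff: "is_expansion m \<beta> x w \<longleftrightarrow> w \<in> words m \<and> val w = x"
  unfolding is_expansion_def word_value_def
  using summable_word sums_unique summable_sums by blast

lemma word_value_nonneg: "w \<in> words m \<Longrightarrow> 0 \<le> val w"
  unfolding word_value_def using base_gt_1 by (intro suminf_nonneg summable_word) simp_all

lemma word_value_reflect:
  assumes "w \<in> words m"
  shows "val (reflect m w) = top_value - val w"
proof -
  have le: "w i \<le> m" for i
    using assms by (auto simp: words_def Pi_iff)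
  have "(\<lambda>i. real m / \<beta> ^ Suc i - real (w i) / \<beta> ^ Suc i) sums (top_value - val w)"
    unfolding word_value_def
    by (intro sums_diff sums_top_value summable_sums summable_word assms)
  then have "(\<lambda>i. real (reflect m w i) / \<beta> ^ Suc i) sums (top_value - val w)"
    using le by (simp add: reflect_def of_nat_diff diff_divide_distrib)
  then show ?thesis
    unfolding word_value_def by (rule sums_unique[symmetric])
qed

lemma word_value_le: "w \<in> words m \<Longrightarrow> val w \<le> top_value"
  using word_value_nonneg[OF reflect_in_words, of w] word_value_reflect[of w] by simp

lemma word_value_shift:
  assumes "w \<in> words m"
  shows "val (shift w) = \<beta> * val w - real (w 0)"
proof -
  have "(\<lambda>i. real (w i) / \<beta> ^ Suc i) sums val w"
    unfolding word_value_def by (rule summable_sums[OF summable_word[OF assms]])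
  then have "(\<lambda>i. real (w (Suc i)) / \<beta> ^ Suc (Suc i)) sums (val w - real (w 0) / \<beta>)"
    by (subst sums_Suc_iff) simp
  then have "(\<lambda>i. \<beta> * (real (w (Suc i)) / \<beta> ^ Suc (Suc i))) sums (\<beta> * (val w - real (w 0) / \<beta>))"
    by (rule sums_mult)
  then have "(\<lambda>i. real (shift w i) / \<beta> ^ Suc i) sums (\<beta> * val w - real (w 0))"
    using base_gt_1 by (simp add: shift_def right_diff_distrib)
  then show ?thesis
    unfolding word_value_def by (rule sums_unique[symmetric])
qed

lemma word_value_funpow_Suc:
  assumes "w \<in> words m"
  shows "val ((shift ^^ Suc n) w) = \<beta> * val ((shift ^^ n) w) - real (w n)"
  using word_value_shift[OF shift_in_words[OF assms, of n]] by (simp add: funpow_shift)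

lemma word_value_common_prefix:
  assumes "u \<in> words m" "v \<in> words m" "\<And>i. i < n \<Longrightarrow> u i = v i"
  shows "val ((shift ^^ n) u) - val ((shift ^^ n) v) = \<beta> ^ n * (val u - val v)"
  using assms(3)
proof (induction n)
  case (Suc n)
  have "val ((shift ^^ Suc n) u) - val ((shift ^^ Suc n) v)
      = \<beta> * (val ((shift ^^ n) u) - val ((shift ^^ n) v))"
    using Suc.prems by (simp only: word_value_funpow_Suc assms(1,2)) (simp add: algebra_simps)
  then show ?case
    using Suc by simp
qed simp

section \<open>Words as itineraries\<close>

lemma piece_index_eq:
  assumes "\<exists>!k. k \<le> m \<and> y \<in> P k"
  shows "piece_index m P y \<le> m" "y \<in> P (piece_index m P y)"
  using theI'[OF assms] by (simp_all add: piece_index_def)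

text \<open>
  An itinerary inside a bounded invariant set is an expansion: unfolding \<open>y = (k + T\<^sub>k y)/\<beta>\<close>
  along the orbit telescopes, and the remainder is divided by growing powers of \<open>\<beta>\<close>.
\<close>

lemma itinerary_expansion:
  assumes bound: "D \<subseteq> {0..B}"
    and piece: "\<And>y. y \<in> D \<Longrightarrow> \<exists>!k. k \<le> m \<and> y \<in> P k"
    and invariant: "\<And>y k. y \<in> D \<Longrightarrow> k \<le> m \<Longrightarrow> y \<in> P k \<Longrightarrow> \<beta> * y - real k \<in> D"
    and "x \<in> D"
  defines "w \<equiv> itinerary m \<beta> P x"
  shows "w \<in> words m" "val w = x" "val ((shift ^^ n) w) \<in> D"
proof -
  define r where "r n = (piecewise_map m \<beta> P ^^ n) x" for n
  have w: "w n = piece_index m P (r n)" for n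
    by (simp add: w_def r_def itinerary_def)
  have step: "r (Suc n) = \<beta> * r n - real (w n)" for n
    unfolding w by (simp add: r_def piecewise_map_def branch_def)
  have r: "r n \<in> D" for n
  proof (induction n)
    case (Suc n)
    show ?case
      unfolding step by (rule invariant[OF Suc]) (simp_all add: w piece_index_eq[where P=P, OF piece[OF Suc]])
  qed (simp add: r_def \<open>x \<in> D\<close>)
  show words: "w \<in> words m"
    using piece_index_eq(1)[where P=P, OF piece[OF r]] by (simp add: words_def w)
  have "(\<lambda>n. r n / \<beta> ^ n) \<longlonglongrightarrow> 0"
  proof (rule tendsto_sandwich[OF _ _ tendsto_const])
    have B: "0 \<le> r n" "r n \<le> B" for n
      using bound r[of n] by auto
    show "\<forall>\<^sub>F n in sequentially. 0 \<le> r n / \<beta> ^ n"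
      using base_gt_1 B by simp
    show "\<forall>\<^sub>F n in sequentially. r n / \<beta> ^ n \<le> B * (1 / \<beta>) ^ n"
      using base_gt_1 B by (simp add: power_divide divide_right_mono)
    have "(\<lambda>n. (1 / \<beta>) ^ n) \<longlonglongrightarrow> 0"
      by (rule LIMSEQ_realpow_zero) (use base_gt_1 in simp_all)
    then show "(\<lambda>n. B * (1 / \<beta>) ^ n) \<longlonglongrightarrow> 0"
      using tendsto_mult_right_zero by blast
  qed
  then have "(\<lambda>n. r n / \<beta> ^ n - r (Suc n) / \<beta> ^ Suc n) sums (r 0 / \<beta> ^ 0 - 0)"
    by (rule telescope_sums')
  moreover have "r n / \<beta> ^ n - r (Suc n) / \<beta> ^ Suc n = real (w n) / \<beta> ^ Suc n" for n
    unfolding step using base_gt_1 by (simp add: field_simps)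
  ultimately show start: "val w = x"
    unfolding word_value_def by (simp add: sums_iff r_def)
  have "val ((shift ^^ n) w) = r n"
  proof (induction n)
    case 0
    show ?case by (simp add: start r_def)
  next
    case (Suc n)
    then show ?case by (simp only: word_value_funpow_Suc[OF words] step)
  qed
  then show "val ((shift ^^ n) w) \<in> D"
    using r by simp
qed

text \<open>
  Consecutive tail values are related by \<open>y \<mapsto> \<beta> y - w\<^sub>n\<close>, so as long as the digits agree with the
  piece indices, the orbit of \<open>val w\<close> is the sequence of tail values.
\<close>

lemma eq_itinerary_iff:
  assumes piece: "\<And>y. y \<in> {0..top_value} \<Longrightarrow> \<exists>!k. k \<le> m \<and> y \<in> P k"
    and w: "w \<in> words m"
  shows "w = itinerary m \<beta> P (val w) \<longleftrightarrow> (\<forall>n. val ((shift ^^ n) w) \<in> P (w n))"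
proof -
  define r where "r n = (piecewise_map m \<beta> P ^^ n) (val w)" for n
  have step: "r (Suc n) = \<beta> * r n - real (piece_index m P (r n))" for n
    by (simp add: r_def piecewise_map_def branch_def)
  have range: "val ((shift ^^ n) w) \<in> {0..top_value}" for n
    using word_value_nonneg word_value_le shift_in_words[OF w] by simp
  have index: "w n = piece_index m P (val ((shift ^^ n) w)) \<longleftrightarrow> val ((shift ^^ n) w) \<in> P (w n)" for n
  proof -
    have "w n \<le> m"
      using w by (auto simp: words_def Pi_iff)
    then show ?thesis
      using piece[OF range[of n]] piece_index_eq[where P=P, OF piece[OF range[of n]]] by metis
  qed
  have "w = itinerary m \<beta> P (val w) \<longleftrightarrow> (\<forall>n. w n = piece_index m P (r n))"
    by (simp add: fun_eq_iff itinerary_def r_def)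
  also have "\<dots> \<longleftrightarrow> (\<forall>n. w n = piece_index m P (val ((shift ^^ n) w)))"
  proof
    assume digits: "\<forall>n. w n = piece_index m P (r n)"
    have "val ((shift ^^ n) w) = r n" for n
    proof (induction n)
      case (Suc n)
      show ?case by (simp only: word_value_funpow_Suc[OF w] step digits[rule_format, of n] Suc)
    qed (simp add: r_def)
    then show "\<forall>n. w n = piece_index m P (val ((shift ^^ n) w))"
      using digits by simp
  next
    assume digits: "\<forall>n. w n = piece_index m P (val ((shift ^^ n) w))"
    have "r n = val ((shift ^^ n) w)" for n
    proof (induction n)
      case (Suc n)
      show ?case by (simp only: word_value_funpow_Suc[OF w] step digits[rule_format, of n] Suc)
    qed (simp add: r_def)
    then show "\<forall>n. w n = piece_index m P (r n)"
      using digits by simp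
  qed
  finally show ?thesis
    using index by simp
qed

section \<open>Greedy, lazy and unique expansions\<close>

lemma lower_end_bounds:
  "lower_end \<beta> k \<le> y \<longleftrightarrow> real k \<le> \<beta> * y" "lower_end \<beta> k < y \<longleftrightarrow> real k < \<beta> * y"
  "y \<le> lower_end \<beta> k \<longleftrightarrow> \<beta> * y \<le> real k" "y < lower_end \<beta> k \<longleftrightarrow> \<beta> * y < real k"
  using base_gt_1 by (simp_all add: lower_end_def field_simps)

lemma upper_end_bounds:
  "y \<le> upper_end m \<beta> k \<longleftrightarrow> \<beta> * y \<le> real k + top_value"
  "upper_end m \<beta> k < y \<longleftrightarrow> real k + top_value < \<beta> * y"
proof -
  have upper: "\<beta> * upper_end m \<beta> k = real k + top_value"
    using base_gt_1 by (simp add: upper_end_def distrib_left)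
  have scale: "a \<le> b \<longleftrightarrow> \<beta> * a \<le> \<beta> * b" "a < b \<longleftrightarrow> \<beta> * a < \<beta> * b" for a b
    using base_gt_1 by simp_all
  show "y \<le> upper_end m \<beta> k \<longleftrightarrow> \<beta> * y \<le> real k + top_value"
    by (simp only: scale(1)[of y] upper)
  show "upper_end m \<beta> k < y \<longleftrightarrow> real k + top_value < \<beta> * y"
    by (simp only: scale(2)[of _ y] upper)
qed

lemma last_upper_end: "upper_end m \<beta> m = top_value"
  using base_gt_1 by (simp add: upper_end_def field_simps)

lemma mem_greedy_piece_iff:
  assumes "y \<in> {0..top_value}" "k \<le> m"
  shows "y \<in> greedy_piece m \<beta> k \<longleftrightarrow> real k \<le> \<beta> * y \<and> (k < m \<longrightarrow> \<beta> * y < real k + 1)"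
  using assms unfolding greedy_piece_def by (auto simp: lower_end_bounds last_upper_end)

lemma mem_lazy_piece_iff:
  assumes "y \<in> {0..top_value}" "k \<le> m"
  shows "y \<in> lazy_piece m \<beta> k \<longleftrightarrow> top_value - y \<in> greedy_piece m \<beta> (m - k)"
proof -
  have "y \<in> lazy_piece m \<beta> k \<longleftrightarrow>
      \<beta> * y \<le> real k + top_value \<and> (0 < k \<longrightarrow> real (k - 1) + top_value < \<beta> * y)"
    using assms(1) by (auto simp: lazy_piece_def upper_end_bounds)
  also have "\<dots> \<longleftrightarrow> real (m - k) \<le> \<beta> * (top_value - y) \<and>
      (m - k < m \<longrightarrow> \<beta> * (top_value - y) < real (m - k) + 1)"
    using assms(2) m_pos top_value_fixed by (auto simp: right_diff_distrib of_nat_diff)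
  also have "\<dots> \<longleftrightarrow> top_value - y \<in> greedy_piece m \<beta> (m - k)"
    using assms by (subst mem_greedy_piece_iff) auto
  finally show ?thesis .
qed

lemma mem_quasi_greedy_piece_iff:
  assumes "y \<in> {0<..1}" "k \<le> m"
  shows "y \<in> quasi_greedy_piece m \<beta> k \<longleftrightarrow> real k < \<beta> * y \<and> (k < m \<longrightarrow> \<beta> * y \<le> real k + 1)"
proof -
  have "y \<le> top_value"
    by (rule order_trans[OF _ one_le_top_value]) (use assms(1) in simp)
  moreover have "0 < \<beta> * y"
    using assms(1) base_gt_1 by simp
  ultimately show ?thesis
    using assms m_pos unfolding quasi_greedy_piece_def
    by (auto simp: lower_end_bounds last_upper_end)
qed

lemma ex1_greedy_piece:
  assumes "y \<in> {0..top_value}"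
  shows "\<exists>!k. k \<le> m \<and> y \<in> greedy_piece m \<beta> k"
proof -
  have "0 \<le> \<beta> * y"
    using assms base_gt_1 by simp
  define k where "k = min m (nat \<lfloor>\<beta> * y\<rfloor>)"
  have "k \<le> m" "real k \<le> \<beta> * y" "k < m \<longrightarrow> \<beta> * y < real k + 1"
    using \<open>0 \<le> \<beta> * y\<close> unfolding k_def by (auto simp: min_def) linarith+
  moreover have "j = k" if "j \<le> m" "real j \<le> \<beta> * y" "j < m \<longrightarrow> \<beta> * y < real j + 1" for j
    using that calculation by (cases "j < k"; cases "k < j") linarith+
  ultimately have "\<exists>!k. k \<le> m \<and> real k \<le> \<beta> * y \<and> (k < m \<longrightarrow> \<beta> * y < real k + 1)"
    by blast
  then show ?thesis
    using mem_greedy_piece_iff[OF assms] by (simp cong: conj_cong)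
qed

lemma ex1_lazy_piece:
  assumes "y \<in> {0..top_value}"
  shows "\<exists>!k. k \<le> m \<and> y \<in> lazy_piece m \<beta> k"
proof -
  have "\<exists>!k. k \<le> m \<and> top_value - y \<in> greedy_piece m \<beta> k"
    using assms by (intro ex1_greedy_piece) auto
  then obtain k where k: "k \<le> m" "top_value - y \<in> greedy_piece m \<beta> k"
    and unique: "\<And>j. j \<le> m \<Longrightarrow> top_value - y \<in> greedy_piece m \<beta> j \<Longrightarrow> j = k"
    by blast
  show ?thesis
  proof (intro ex1I[of _ "m - k"] conjI)
    show "y \<in> lazy_piece m \<beta> (m - k)"
      using k by (subst mem_lazy_piece_iff[OF assms]) simp_all
  next
    fix j assume j: "j \<le> m \<and> y \<in> lazy_piece m \<beta> j"
    then have "m - j = k"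
      using mem_lazy_piece_iff[OF assms, of j] by (intro unique) auto
    then show "j = m - k"
      using j by linarith
  qed simp
qed

lemma ex1_quasi_greedy_piece:
  assumes "y \<in> {0<..1}"
  shows "\<exists>!k. k \<le> m \<and> y \<in> quasi_greedy_piece m \<beta> k"
proof -
  have "0 < \<beta> * y"
    using assms base_gt_1 by simp
  define k where "k = min m (nat (\<lceil>\<beta> * y\<rceil> - 1))"
  have "k \<le> m" "real k < \<beta> * y" "k < m \<longrightarrow> \<beta> * y \<le> real k + 1"
    using \<open>0 < \<beta> * y\<close> unfolding k_def by (auto simp: min_def) linarith+
  moreover have "j = k" if "j \<le> m" "real j < \<beta> * y" "j < m \<longrightarrow> \<beta> * y \<le> real j + 1" for j
    using that calculation by (cases "j < k"; cases "k < j") linarith+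
  ultimately have "\<exists>!k. k \<le> m \<and> real k < \<beta> * y \<and> (k < m \<longrightarrow> \<beta> * y \<le> real k + 1)"
    by blast
  then show ?thesis
    using mem_quasi_greedy_piece_iff[OF assms] by (simp cong: conj_cong)
qed

text \<open>
  The left end of the greedy piece only says that the remainder is nonnegative, which holds for
  every tail value; the right end says that the digit cannot be increased.
\<close>

lemma eq_greedy_expansion_iff:
  assumes w: "w \<in> words m"
  shows "w = greedy_expansion m \<beta> (val w) \<longleftrightarrow> (\<forall>n. w n < m \<longrightarrow> val ((shift ^^ Suc n) w) < 1)"
proof -
  have "val ((shift ^^ n) w) \<in> greedy_piece m \<beta> (w n) \<longleftrightarrow>
      (w n < m \<longrightarrow> val ((shift ^^ Suc n) w) < 1)" for n
  proof -
    have "val ((shift ^^ n) w) \<in> {0..top_value}" "w n \<le> m"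
      using word_value_nonneg word_value_le shift_in_words[OF w] w by (auto simp: words_def Pi_iff)
    from mem_greedy_piece_iff[OF this] show ?thesis
      using word_value_nonneg[OF shift_in_words[OF w, of "Suc n"]] word_value_funpow_Suc[OF w, of n]
      by linarith
  qed
  then show ?thesis
    unfolding greedy_expansion_def
    by (simp only: eq_itinerary_iff[of "greedy_piece m \<beta>", OF ex1_greedy_piece w])
qed

lemma eq_lazy_expansion_iff:
  assumes w: "w \<in> words m"
  shows "w = lazy_expansion m \<beta> (val w) \<longleftrightarrow>
    reflect m w = greedy_expansion m \<beta> (val (reflect m w))"
proof -
  have "val ((shift ^^ n) w) \<in> lazy_piece m \<beta> (w n) \<longleftrightarrow>
      val ((shift ^^ n) (reflect m w)) \<in> greedy_piece m \<beta> (reflect m w n)" for n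
  proof -
    have "val ((shift ^^ n) w) \<in> {0..top_value}" "w n \<le> m"
      using word_value_nonneg word_value_le shift_in_words[OF w] w by (auto simp: words_def Pi_iff)
    from mem_lazy_piece_iff[OF this] show ?thesis
      unfolding funpow_shift_reflect word_value_reflect[OF shift_in_words[OF w]]
      by (simp add: reflect_def)
  qed
  then show ?thesis
    unfolding lazy_expansion_def greedy_expansion_def
    by (simp only: eq_itinerary_iff[of "lazy_piece m \<beta>", OF ex1_lazy_piece w]
        eq_itinerary_iff[of "greedy_piece m \<beta>", OF ex1_greedy_piece reflect_in_words])
qed

lemma greedy_expansion_expands:
  assumes "x \<in> {0..top_value}"
  shows "is_expansion m \<beta> x (greedy_expansion m \<beta> x)"
proof -
  have "\<beta> * y - real k \<in> {0..top_value}"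
    if "y \<in> {0..top_value}" "k \<le> m" "y \<in> greedy_piece m \<beta> k" for y k
  proof -
    have k: "real k \<le> \<beta> * y" "k < m \<longrightarrow> \<beta> * y < real k + 1"
      using mem_greedy_piece_iff[OF that(1,2)] that(3) by auto
    have "\<beta> * y \<le> \<beta> * top_value"
      using that(1) base_gt_1 by (intro mult_left_mono) auto
    then show ?thesis
      using k one_le_top_value top_value_fixed that(2) by (cases "k < m") auto
  qed
  from itinerary_expansion[where P = "greedy_piece m \<beta>", OF order_refl ex1_greedy_piece this assms] show ?thesis
    by (simp add: is_expansion_iff greedy_expansion_def)
qed

lemma greedy_if_unique:
  assumes "is_unique_expansion m \<beta> (val w) w"
  shows "w = greedy_expansion m \<beta> (val w)"
proof -
  have w: "w \<in> words m"
    using assms by (simp add: is_unique_expansion_def is_expansion_iff)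
  have "is_expansion m \<beta> (val w) (greedy_expansion m \<beta> (val w))"
    using word_value_nonneg[OF w] word_value_le[OF w] by (intro greedy_expansion_expands) simp
  then show ?thesis
    using assms unfolding is_unique_expansion_def by metis
qed

lemma unique_expansion_reflect:
  assumes "is_unique_expansion m \<beta> (val w) w"
  shows "is_unique_expansion m \<beta> (val (reflect m w)) (reflect m w)"
proof -
  have w: "w \<in> words m" and unique: "\<And>v. v \<in> words m \<Longrightarrow> val v = val w \<Longrightarrow> v = w"
    using assms by (auto simp: is_unique_expansion_def is_expansion_iff)
  have "v = reflect m w" if "v \<in> words m" "val v = val (reflect m w)" for v
  proof -
    have "val (reflect m v) = val w"
      using that w by (simp add: word_value_reflect)
    then show ?thesis
      using unique[OF reflect_in_words] reflect_reflect that(1) by metis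
  qed
  then show ?thesis
    by (simp add: is_unique_expansion_def is_expansion_iff reflect_in_words)
qed

text \<open>
  At a first digit exceeding the greedy one, the two remainders differ by at least \<open>1\<close>, while the
  greedy remainder is less than \<open>1\<close>; the other remainder would be negative.
\<close>

lemma greedy_digit_maximal:
  assumes w: "w \<in> words m" and greedy: "w = greedy_expansion m \<beta> (val w)"
    and v: "v \<in> words m" and "val v = val w" and prefix: "\<And>i. i < n \<Longrightarrow> v i = w i"
  shows "v n \<le> w n"
proof (rule ccontr)
  assume "\<not> v n \<le> w n"
  moreover have "v n \<le> m"
    using v by (auto simp: words_def Pi_iff)
  ultimately have "w n < m" and digit: "real (w n) + 1 \<le> real (v n)"
    by linarith+
  have "val ((shift ^^ Suc n) w) < 1"
    using greedy eq_greedy_expansion_iff[OF w] \<open>w n < m\<close> by blast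
  moreover have "val ((shift ^^ n) v) = val ((shift ^^ n) w)"
    using word_value_common_prefix[OF v w, of n] prefix \<open>val v = val w\<close> by simp
  then have "val ((shift ^^ Suc n) v) = val ((shift ^^ Suc n) w) + real (w n) - real (v n)"
    unfolding word_value_funpow_Suc[OF w] word_value_funpow_Suc[OF v] by simp
  moreover have "0 \<le> val ((shift ^^ Suc n) v)"
    by (rule word_value_nonneg[OF shift_in_words[OF v]])
  ultimately show False
    using digit by linarith
qed

lemma unique_iff_greedy_lazy:
  assumes w: "w \<in> words m"
  shows "is_unique_expansion m \<beta> (val w) w \<longleftrightarrow>
    w = greedy_expansion m \<beta> (val w) \<and> w = lazy_expansion m \<beta> (val w)"
    (is "?unique \<longleftrightarrow> ?greedy \<and> ?lazy")
proof
  assume ?unique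
  then show "?greedy \<and> ?lazy"
    using greedy_if_unique unique_expansion_reflect eq_lazy_expansion_iff[OF w] by blast
next
  assume extremal: "?greedy \<and> ?lazy"
  have "v = w" if v: "v \<in> words m" "val v = val w" for v
  proof
    fix n
    show "v n = w n"
    proof (induction n rule: less_induct)
      case (less n)
      have "v n \<le> w n"
        using extremal less v by (intro greedy_digit_maximal[OF w]) auto
      moreover have "reflect m v n \<le> reflect m w n"
      proof (rule greedy_digit_maximal[OF reflect_in_words _ reflect_in_words])
        show "reflect m w = greedy_expansion m \<beta> (val (reflect m w))"
          using extremal eq_lazy_expansion_iff[OF w] by blast
        show "val (reflect m v) = val (reflect m w)"
          using v w by (simp add: word_value_reflect)
        show "reflect m v i = reflect m w i" if "i < n" for i
          using less[OF that] by (simp add: reflect_def)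
      qed
      moreover have "v n \<le> m" "w n \<le> m"
        using v w by (auto simp: words_def Pi_iff)
      ultimately show "v n = w n"
        by (simp add: reflect_def)
    qed
  qed
  then show ?unique
    using w by (simp add: is_unique_expansion_def is_expansion_iff)
qed

section \<open>Lexicographic comparison with the quasi-greedy expansion of one\<close>

abbreviation quasi_one :: "nat \<Rightarrow> nat" where
  "quasi_one \<equiv> quasi_greedy_expansion m \<beta> 1"

text \<open>The quasi-greedy map preserves \<open>(0, 1]\<close>; for the last digit this is where \<open>\<beta> \<le> m + 1\<close> enters.\<close>

lemma quasi_one:
  shows quasi_one_in_words: "quasi_one \<in> words m"
    and quasi_one_value: "val quasi_one = 1"
    and quasi_one_tail: "val ((shift ^^ n) quasi_one) \<in> {0<..1}"
proof -
  have invariant: "\<beta> * y - real k \<in> {0<..1}"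
    if "y \<in> {0<..1}" "k \<le> m" "y \<in> quasi_greedy_piece m \<beta> k" for y k
  proof -
    have k: "real k < \<beta> * y" "k < m \<longrightarrow> \<beta> * y \<le> real k + 1"
      using mem_quasi_greedy_piece_iff[OF that(1,2)] that(3) by auto
    have "\<beta> * y \<le> \<beta> * 1"
      using that(1) base_gt_1 by (intro mult_left_mono) auto
    then show ?thesis
      using k base_le that(2) by (cases "k < m") auto
  qed
  have sub: "{0<..1} \<subseteq> {0..1::real}"
    by auto
  have one: "1 \<in> {0<..1::real}"
    by simp
  note itin = itinerary_expansion[where P = "quasi_greedy_piece m \<beta>",
      OF sub ex1_quasi_greedy_piece invariant one, folded quasi_greedy_expansion_def]
  show "quasi_one \<in> words m" "val quasi_one = 1" "val ((shift ^^ n) quasi_one) \<in> {0<..1}"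
    by (rule itin; assumption)+
qed

text \<open>
  What follows any digit of \<open>g\<^sup>*(1)\<close> has value at most \<open>1\<close>. Hence a word that is larger at the
  first difference makes up for the rest of \<open>g\<^sup>*(1)\<close> by this digit alone, and its value is at
  least \<open>1\<close>.
\<close>

lemma less_fun_if_word_value_less:
  assumes v: "v \<in> words m" and "val v < 1"
  shows "less_fun v quasi_one"
proof (rule ccontr)
  assume not_less: "\<not> less_fun v quasi_one"
  have "v \<noteq> quasi_one"
    using \<open>val v < 1\<close> quasi_one_value by auto
  then obtain j where "v j \<noteq> quasi_one j"
    by (auto simp: fun_eq_iff)
  then obtain n where differ: "v n \<noteq> quasi_one n" and prefix: "\<And>i. i < n \<Longrightarrow> v i = quasi_one i"
    using exists_least_iff[of "\<lambda>n. v n \<noteq> quasi_one n"] by blast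
  have digit: "real (quasi_one n) + 1 \<le> real (v n)"
  proof -
    have "\<not> v n < quasi_one n"
      using not_less prefix by (auto simp: less_fun_def)
    then show ?thesis
      using differ by linarith
  qed
  have "\<beta> ^ n * (val v - 1) < 0"
    using \<open>val v < 1\<close> base_gt_1 by (intro mult_pos_neg) auto
  then have "val ((shift ^^ n) v) < val ((shift ^^ n) quasi_one)"
    using word_value_common_prefix[OF v quasi_one_in_words, of n] prefix quasi_one_value by simp
  then have "\<beta> * val ((shift ^^ n) v) < \<beta> * val ((shift ^^ n) quasi_one)"
    using base_gt_1 by simp
  moreover have "0 \<le> val ((shift ^^ Suc n) v)"
    by (rule word_value_nonneg[OF shift_in_words[OF v]])
  moreover have "val ((shift ^^ Suc n) quasi_one) \<le> 1"
    using quasi_one_tail[of "Suc n"] by auto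
  ultimately show False
    using digit unfolding word_value_funpow_Suc[OF v] word_value_funpow_Suc[OF quasi_one_in_words]
    by linarith
qed

definition tails_below :: "(nat \<Rightarrow> nat) \<Rightarrow> bool" where
  "tails_below v \<longleftrightarrow> (\<forall>n. v n < m \<longrightarrow> less_fun ((shift ^^ Suc n) v) quasi_one)"

lemma tails_below_shift:
  assumes "tails_below v"
  shows "tails_below ((shift ^^ n) v)"
proof -
  have "(shift ^^ Suc k) ((shift ^^ n) v) = (shift ^^ Suc (n + k)) v" for k
    unfolding funpow_shift by (simp add: add_ac)
  then show ?thesis
    using assms unfolding tails_below_def by (simp only: funpow_shift[of n]) blast
qed

text \<open>
  The estimate at the first difference: the defect \<open>1 - val v\<close> dominates a scaled defect of a
  later tail that satisfies the same hypotheses. It is strict because the tails of \<open>g\<^sup>*(1)\<close> have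
  positive values.
\<close>

lemma defect_step:
  assumes v: "v \<in> words m" and "less_fun v quasi_one" and "tails_below v"
  obtains n where "less_fun ((shift ^^ Suc n) v) quasi_one" "tails_below ((shift ^^ Suc n) v)"
    "1 - val ((shift ^^ Suc n) v) < \<beta> ^ Suc n * (1 - val v)"
proof -
  obtain n where digit: "v n < quasi_one n" and prefix: "\<And>i. i < n \<Longrightarrow> v i = quasi_one i"
    using \<open>less_fun v quasi_one\<close> by (auto simp: less_fun_def)
  have "quasi_one n \<le> m"
    using quasi_one_in_words by (auto simp: words_def Pi_iff)
  then have "less_fun ((shift ^^ Suc n) v) quasi_one"
    using digit \<open>tails_below v\<close> by (simp add: tails_below_def)
  moreover have "tails_below ((shift ^^ Suc n) v)"
    by (rule tails_below_shift[OF \<open>tails_below v\<close>])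
  moreover have "1 - val ((shift ^^ Suc n) v) < \<beta> ^ Suc n * (1 - val v)"
  proof -
    have "val ((shift ^^ n) quasi_one) - val ((shift ^^ n) v) = \<beta> ^ n * (1 - val v)"
      using word_value_common_prefix[OF quasi_one_in_words v] prefix quasi_one_value by simp
    then have "\<beta> * val ((shift ^^ n) quasi_one) - \<beta> * val ((shift ^^ n) v) = \<beta> ^ Suc n * (1 - val v)"
      by (simp add: right_diff_distrib[symmetric])
    moreover have "0 < val ((shift ^^ Suc n) quasi_one)"
      using quasi_one_tail[of "Suc n"] by auto
    ultimately show ?thesis
      using digit unfolding word_value_funpow_Suc[OF v] word_value_funpow_Suc[OF quasi_one_in_words]
      by linarith
  qed
  ultimately show thesis
    using that by blast
qed

text \<open>
  An excess over \<open>1\<close> would be multiplied by at least \<open>\<beta>\<close> at each application of the previous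
  estimate, but excesses are bounded by \<open>m/(\<beta>-1)\<close>. This gives only \<open>\<le> 1\<close>; one more application
  makes it strict.
\<close>

lemma word_value_less_if_less_fun:
  assumes "v \<in> words m" "less_fun v quasi_one" "tails_below v"
  shows "val v < 1"
proof -
  have scaled: "\<beta> ^ k * (val v - 1) \<le> top_value"
    if "v \<in> words m" "less_fun v quasi_one" "tails_below v" for k v
    using that
  proof (induction k arbitrary: v)
    case 0
    then show ?case using word_value_le[of v] by simp
  next
    case (Suc k)
    obtain n where n: "less_fun ((shift ^^ Suc n) v) quasi_one" "tails_below ((shift ^^ Suc n) v)"
      "1 - val ((shift ^^ Suc n) v) < \<beta> ^ Suc n * (1 - val v)"
      using defect_step Suc.prems by blast
    have IH: "\<beta> ^ k * (val ((shift ^^ Suc n) v) - 1) \<le> top_value"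
      using Suc n shift_in_words by blast
    show ?case
    proof (cases "val v \<le> 1")
      case True
      then have "\<beta> ^ Suc k * (val v - 1) \<le> 0"
        using base_gt_1 by (intro mult_nonneg_nonpos) auto
      then show ?thesis
        using one_le_top_value by linarith
    next
      case False
      have "\<beta> ^ 1 \<le> \<beta> ^ Suc n"
        using base_gt_1 by (intro power_increasing) auto
      then have "\<beta> * (val v - 1) \<le> \<beta> ^ Suc n * (val v - 1)"
        using False by (intro mult_right_mono) auto
      also have "\<dots> \<le> val ((shift ^^ Suc n) v) - 1"
        using n(3) by (simp add: algebra_simps)
      finally have "\<beta> ^ k * (\<beta> * (val v - 1)) \<le> \<beta> ^ k * (val ((shift ^^ Suc n) v) - 1)"
        using base_gt_1 by (intro mult_left_mono) auto
      then show ?thesis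
        using IH by (simp add: mult.assoc mult.left_commute)
    qed
  qed
  have le_1: "val v \<le> 1" if "v \<in> words m" "less_fun v quasi_one" "tails_below v" for v
  proof (rule ccontr)
    assume "\<not> val v \<le> 1"
    then obtain k where "top_value / (val v - 1) < \<beta> ^ k"
      using real_arch_pow[OF base_gt_1] by blast
    moreover have "0 < val v - 1"
      using \<open>\<not> val v \<le> 1\<close> by simp
    ultimately have "top_value < \<beta> ^ k * (val v - 1)"
      using pos_divide_less_eq by blast
    then show False
      using scaled[OF that, of k] by linarith
  qed
  obtain n where n: "less_fun ((shift ^^ Suc n) v) quasi_one" "tails_below ((shift ^^ Suc n) v)"
    "1 - val ((shift ^^ Suc n) v) < \<beta> ^ Suc n * (1 - val v)"
    using defect_step assms by blast
  have "0 < \<beta> ^ Suc n * (1 - val v)"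
    using le_1[OF shift_in_words[OF assms(1)] n(1,2)] n(3) by linarith
  then show ?thesis
    using zero_less_mult_pos[of "\<beta> ^ Suc n" "1 - val v"] base_gt_1 by simp
qed

lemma greedy_iff_tails_below:
  assumes w: "w \<in> words m"
  shows "w = greedy_expansion m \<beta> (val w) \<longleftrightarrow> tails_below w"
  unfolding eq_greedy_expansion_iff[OF w]
proof
  assume "\<forall>n. w n < m \<longrightarrow> val ((shift ^^ Suc n) w) < 1"
  then show "tails_below w"
    unfolding tails_below_def using less_fun_if_word_value_less shift_in_words[OF w] by blast
next
  assume below: "tails_below w"
  show "\<forall>n. w n < m \<longrightarrow> val ((shift ^^ Suc n) w) < 1"
  proof (intro allI impI)
    fix n assume "w n < m"
    then have "less_fun ((shift ^^ Suc n) w) quasi_one"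
      using below unfolding tails_below_def by blast
    then show "val ((shift ^^ Suc n) w) < 1"
      by (rule word_value_less_if_less_fun[OF shift_in_words[OF w] _ tails_below_shift[OF below]])
  qed
qed

lemma small_greedy_iff:
  assumes w: "w \<in> words m"
  shows "val w < 1 \<and> w = greedy_expansion m \<beta> (val w) \<longleftrightarrow>
    (\<forall>n. less_fun ((shift ^^ n) w) quasi_one)"
    (is "?L \<longleftrightarrow> ?R")
proof
  assume L: ?L
  \<comment> \<open>The greedy map preserves \<open>[0, 1)\<close>: after a digit \<open>m\<close> the remainder is \<open>\<beta> y - m < \<beta> - m \<le> 1\<close>.\<close>
  have "val ((shift ^^ n) w) < 1" for n
  proof (induction n)
    case (Suc n)
    show ?case
    proof (cases "w n < m")
      case True
      then show ?thesis
        using L eq_greedy_expansion_iff[OF w] by blast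
    next
      case False
      have "\<beta> * val ((shift ^^ n) w) < \<beta> * 1"
        using Suc base_gt_1 by (intro mult_strict_left_mono) auto
      then show ?thesis
        unfolding word_value_funpow_Suc[OF w] using base_le False by linarith
    qed
  qed (use L in simp)
  then show ?R
    using less_fun_if_word_value_less shift_in_words[OF w] by blast
next
  assume R: ?R
  then have below: "tails_below w"
    unfolding tails_below_def by blast
  moreover have "less_fun w quasi_one"
    using R[rule_format, of 0] by simp
  ultimately show ?L
    using greedy_iff_tails_below[OF w] word_value_less_if_less_fun[OF w] by blast
qed

lemma less_fun_reflect_shift:
  assumes "w \<in> words m"
  shows "less_fun ((shift ^^ n) (reflect m w)) quasi_one \<longleftrightarrow>
    less_fun (reflect m quasi_one) ((shift ^^ n) w)"
  using less_fun_reflect_left[OF quasi_one_in_words shift_in_words[OF assms]]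
  by (simp add: funpow_shift_reflect)

lemma lazy_iff_tails_above:
  assumes w: "w \<in> words m"
  shows "w = lazy_expansion m \<beta> (val w) \<longleftrightarrow>
    (\<forall>n. 0 < w n \<longrightarrow> less_fun (reflect m quasi_one) ((shift ^^ Suc n) w))"
proof -
  have "reflect m w n < m \<longleftrightarrow> 0 < w n" for n
    using m_pos by (auto simp: reflect_def)
  then show ?thesis
    unfolding eq_lazy_expansion_iff[OF w] greedy_iff_tails_below[OF reflect_in_words] tails_below_def
      less_fun_reflect_shift[OF w] by simp
qed

lemma large_lazy_iff:
  assumes w: "w \<in> words m"
  shows "top_value - 1 < val w \<and> w = lazy_expansion m \<beta> (val w) \<longleftrightarrow>
    (\<forall>n. less_fun (reflect m quasi_one) ((shift ^^ n) w))"
proof -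
  have "top_value - 1 < val w \<longleftrightarrow> val (reflect m w) < 1"
    using word_value_reflect[OF w] by linarith
  then show ?thesis
    using small_greedy_iff[OF reflect_in_words, of w]
    unfolding eq_lazy_expansion_iff[OF w] less_fun_reflect_shift[OF w] by simp
qed

end

theorem corollary1p6:
  fixes m :: nat and \<beta> x :: real and w :: "nat \<Rightarrow> nat"
  assumes "m \<ge> 1"
    and "1 < \<beta>" and "\<beta> \<le> real m + 1"
    and "x \<in> {0 .. real m / (\<beta> - 1)}"
    and "w \<in> words m"
    and "is_expansion m \<beta> x w"
  shows
    "(w = greedy_expansion m \<beta> x \<longleftrightarrow>
        (\<forall>n\<ge>1. w (n - 1) < m \<longrightarrow>
           less_fun ((shift ^^ n) w) (quasi_greedy_expansion m \<beta> 1))) \<and>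
     (w = lazy_expansion m \<beta> x \<longleftrightarrow>
        (\<forall>n\<ge>1. w (n - 1) > 0 \<longrightarrow>
           less_fun (reflect m (quasi_greedy_expansion m \<beta> 1)) ((shift ^^ n) w))) \<and>
     (is_unique_expansion m \<beta> x w \<longleftrightarrow>
        (\<forall>n\<ge>1. w (n - 1) < m \<longrightarrow>
           less_fun ((shift ^^ n) w) (quasi_greedy_expansion m \<beta> 1)) \<and>
        (\<forall>n\<ge>1. w (n - 1) > 0 \<longrightarrow>
           less_fun (reflect m (quasi_greedy_expansion m \<beta> 1)) ((shift ^^ n) w))) \<and>
     ((0 \<le> x \<and> x < 1) \<and> w = greedy_expansion m \<beta> x \<longleftrightarrow>
        (\<forall>n. less_fun ((shift ^^ n) w) (quasi_greedy_expansion m \<beta> 1))) \<and>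
     ((real m / (\<beta> - 1) - 1 < x \<and> x \<le> real m / (\<beta> - 1)) \<and> w = lazy_expansion m \<beta> x \<longleftrightarrow>
        (\<forall>n. less_fun (reflect m (quasi_greedy_expansion m \<beta> 1)) ((shift ^^ n) w))) \<and>
     ((real m / (\<beta> - 1) - 1 < x \<and> x < 1) \<and> is_unique_expansion m \<beta> x w \<longleftrightarrow>
        (\<forall>n. less_fun (reflect m (quasi_greedy_expansion m \<beta> 1)) ((shift ^^ n) w) \<and>
             less_fun ((shift ^^ n) w) (quasi_greedy_expansion m \<beta> 1)))"
proof -
  interpret digit_system m \<beta>
    by unfold_locales (use assms in auto)
  have w: "w \<in> words m" and x: "x = val w"
    using assms(6) by (auto simp: is_expansion_iff)
  have from_1: "(\<forall>n\<ge>1. P (n - 1) n) \<longleftrightarrow> (\<forall>n. P n (Suc n))" for P :: "nat \<Rightarrow> nat \<Rightarrow> bool"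
  proof (intro iffI allI impI)
    fix n assume "\<forall>n\<ge>1. P (n - 1) n"
    then show "P n (Suc n)"
      by (auto dest: spec[of _ "Suc n"])
  next
    fix n :: nat assume "\<forall>n. P n (Suc n)" "1 \<le> n"
    then show "P (n - 1) n"
      by (cases n) simp_all
  qed
  have greedy: "w = greedy_expansion m \<beta> x \<longleftrightarrow>
      (\<forall>n\<ge>1. w (n - 1) < m \<longrightarrow> less_fun ((shift ^^ n) w) quasi_one)"
    unfolding from_1[of "\<lambda>i n. w i < m \<longrightarrow> less_fun ((shift ^^ n) w) quasi_one"] x
      greedy_iff_tails_below[OF w] tails_below_def ..
  have lazy: "w = lazy_expansion m \<beta> x \<longleftrightarrow>
      (\<forall>n\<ge>1. w (n - 1) > 0 \<longrightarrow> less_fun (reflect m quasi_one) ((shift ^^ n) w))"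
    unfolding from_1[of "\<lambda>i n. w i > 0 \<longrightarrow> less_fun (reflect m quasi_one) ((shift ^^ n) w)"] x
    by (rule lazy_iff_tails_above[OF w])
  have unique: "is_unique_expansion m \<beta> x w \<longleftrightarrow>
      w = greedy_expansion m \<beta> x \<and> w = lazy_expansion m \<beta> x"
    unfolding x by (rule unique_iff_greedy_lazy[OF w])
  have small: "x < 1 \<and> w = greedy_expansion m \<beta> x \<longleftrightarrow>
      (\<forall>n. less_fun ((shift ^^ n) w) quasi_one)"
    unfolding x by (rule small_greedy_iff[OF w])
  have large: "top_value - 1 < x \<and> w = lazy_expansion m \<beta> x \<longleftrightarrow>
      (\<forall>n. less_fun (reflect m quasi_one) ((shift ^^ n) w))"
    unfolding x by (rule large_lazy_iff[OF w])
  have range: "0 \<le> x" "x \<le> top_value"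
    using assms(4) by auto
  show ?thesis
    unfolding greedy[symmetric] lazy[symmetric] unique all_conj_distrib
      small[symmetric] large[symmetric]
    using range by blast
qed

end
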